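(* Let $\epsilon\in(0,0.5)$ be a constant and let $\ell\ge k$ with $2^\ell\in\mathbb{N}$ and $k\le\ell-2+\log_2(0.5-\epsilon)$. Suppose $\mathtt{nmE}:[2^\ell]\times[2^\ell]\to\{0,1\}$ is quasi-orthogonal with error $\epsilon$ and is a non-malleable two-source $(k,\epsilon)$-extractor. Let $G=(V_1\cup V_0,E)$ be the $2^{\ell+1}$-vertex graph with $V_\sigma=\{\langle\sigma,i\rangle:i\in[2^\ell]\}$ and $E=\{\{\langle1,i\rangle,\langle0,j\rangle\}:\mathtt{nmE}(i,j)=1\}\cup\binom{V_1}{2}$. Then $G$ is $\Omega(|V_1\cup V_0|)$-robustly self-ordered, i.e., $c\cdot 2^{\ell+1}$-robustly self-ordered for a constant $c>0$ depending only on $\epsilon$. Furthermore, the same conclusion holds even if the non-malleability condition of $\mathtt{nmE}$ is only assumed for permutations $f,g$.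
   Context: A random variable over $[2^\ell]$ is an $(\ell,k)$-source if each value has probability at most $2^{-k}$. $\mathtt{nmE}:[2^\ell]\times[2^\ell]\to\{0,1\}$ is a non-malleable two-source $(k,\epsilon)$-extractor if for every two independent $(\ell,k)$-sources $X,Y$ and every $f,g:[2^\ell]\to[2^\ell]$ without fixed points, $\frac12\sum_{\alpha,\beta\in\{0,1\}}\big|\Pr[(\mathtt{nmE}(X,Y),\mathtt{nmE}(f(X),g(Y)))=(\alpha,\beta)]-\frac12\Pr[\mathtt{nmE}(f(X),g(Y))=\beta]\big|\le\epsilon$. $\mathtt{nmE}$ is quasi-orthogonal with error $\epsilon$ if (1) for every $x$ and $\sigma\in\{0,1\}$, $|\{y:\mathtt{nmE}(x,y)=\sigma\}|\le(0.5+\epsilon)2^\ell$, and symmetrically for every fixed $y$; and (2) for every $x\ne x'$, $|\{y:\mathtt{nmE}(x,y)\ne\mathtt{nmE}(x',y)\}|\ge(0.5-\epsilon)2^\ell$, and symmetrically for every $y\ne y'$. A graph $G=(V,E)$ is $\rho$-robustly self-ordered if for every permutation $\pi$ of $V$, $|E\triangle\{\{\pi(u),\pi(v)\}:\{u,v\}\in E\}|\ge\rho|\{v:\pi(v)\ne v\}|$. *)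

theory Defs
  imports
    "HOL-Probability.Probability"
    "HOL-Combinatorics.Permutations"
    "HOL-Library.Ramsey"
begin

text \<open>
  The set \<open>[2^l]\<close> is rendered as \<open>{1..N}\<close>, where \<open>N\<close> is the natural number \<open>2^l\<close>
  (\<open>l\<close> itself need not be an integer).
\<close>

definition is_source :: "nat \<Rightarrow> real \<Rightarrow> nat pmf \<Rightarrow> bool" where
  "is_source N k X \<longleftrightarrow> set_pmf X \<subseteq> {1..N} \<and> (\<forall>x. pmf X x \<le> 2 powr (- k))"

text \<open>Independence of the two sources is expressed by taking their joint law to be \<open>pair_pmf X Y\<close>.\<close>

definition nm_bias ::
  "(nat \<Rightarrow> nat \<Rightarrow> nat) \<Rightarrow> nat pmf \<Rightarrow> nat pmf \<Rightarrow> (nat \<Rightarrow> nat) \<Rightarrow> (nat \<Rightarrow> nat) \<Rightarrow> real" where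
  "nm_bias nmE X Y f g =
     1 / 2 * (\<Sum>\<alpha>\<in>{0, 1}. \<Sum>\<beta>\<in>{0, 1}.
       \<bar>measure_pmf.prob (pair_pmf X Y) {(x, y). (nmE x y, nmE (f x) (g y)) = (\<alpha>, \<beta>)}
        - 1 / 2 * measure_pmf.prob (pair_pmf X Y) {(x, y). nmE (f x) (g y) = \<beta>}\<bar>)"

text \<open>The parameter \<open>F\<close> is the class of functions from which the tampering functions are drawn.\<close>

definition nm_extractor_against ::
  "(nat \<Rightarrow> nat) set \<Rightarrow> nat \<Rightarrow> real \<Rightarrow> real \<Rightarrow> (nat \<Rightarrow> nat \<Rightarrow> nat) \<Rightarrow> bool" where
  "nm_extractor_against F N k \<epsilon> nmE \<longleftrightarrow>
     (\<forall>X Y. is_source N k X \<longrightarrow> is_source N k Y \<longrightarrow>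
       (\<forall>f\<in>F. \<forall>g\<in>F. (\<forall>x\<in>{1..N}. f x \<noteq> x) \<longrightarrow> (\<forall>y\<in>{1..N}. g y \<noteq> y) \<longrightarrow>
         nm_bias nmE X Y f g \<le> \<epsilon>))"

definition nm_two_source_extractor ::
  "nat \<Rightarrow> real \<Rightarrow> real \<Rightarrow> (nat \<Rightarrow> nat \<Rightarrow> nat) \<Rightarrow> bool" where
  "nm_two_source_extractor N = nm_extractor_against ({1..N} \<rightarrow> {1..N}) N"

definition nm_two_source_extractor_perm ::
  "nat \<Rightarrow> real \<Rightarrow> real \<Rightarrow> (nat \<Rightarrow> nat \<Rightarrow> nat) \<Rightarrow> bool" where
  "nm_two_source_extractor_perm N = nm_extractor_against {f. f permutes {1..N}} N"

definition quasi_orthogonal :: "nat \<Rightarrow> real \<Rightarrow> (nat \<Rightarrow> nat \<Rightarrow> nat) \<Rightarrow> bool" where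
  "quasi_orthogonal N \<epsilon> nmE \<longleftrightarrow>
     (\<forall>x\<in>{1..N}. \<forall>\<sigma>\<in>{0, 1}.
        real (card {y\<in>{1..N}. nmE x y = \<sigma>}) \<le> (1 / 2 + \<epsilon>) * real N) \<and>
     (\<forall>y\<in>{1..N}. \<forall>\<sigma>\<in>{0, 1}.
        real (card {x\<in>{1..N}. nmE x y = \<sigma>}) \<le> (1 / 2 + \<epsilon>) * real N) \<and>
     (\<forall>x\<in>{1..N}. \<forall>x'\<in>{1..N}. x \<noteq> x' \<longrightarrow>
        real (card {y\<in>{1..N}. nmE x y \<noteq> nmE x' y}) \<ge> (1 / 2 - \<epsilon>) * real N) \<and>
     (\<forall>y\<in>{1..N}. \<forall>y'\<in>{1..N}. y \<noteq> y' \<longrightarrow>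
        real (card {x\<in>{1..N}. nmE x y \<noteq> nmE x y'}) \<ge> (1 / 2 - \<epsilon>) * real N)"

text \<open>A simple graph is given by its vertex set and its set of two-element edges.\<close>

definition robustly_self_ordered :: "real \<Rightarrow> 'v set \<Rightarrow> 'v set set \<Rightarrow> bool" where
  "robustly_self_ordered \<rho> V E \<longleftrightarrow>
     (\<forall>\<pi>. \<pi> permutes V \<longrightarrow>
        real (card (sym_diff E {{\<pi> u, \<pi> v} |u v. {u, v} \<in> E}))
          \<ge> \<rho> * real (card {v\<in>V. \<pi> v \<noteq> v}))"

definition side :: "nat \<Rightarrow> nat \<Rightarrow> (nat \<times> nat) set" where
  "side N \<sigma> = {\<sigma>} \<times> {1..N}"

definition ext_graph_verts :: "nat \<Rightarrow> (nat \<times> nat) set" where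
  "ext_graph_verts N = side N 1 \<union> side N 0"

definition ext_graph_edges :: "nat \<Rightarrow> (nat \<Rightarrow> nat \<Rightarrow> nat) \<Rightarrow> (nat \<times> nat) set set" where
  "ext_graph_edges N nmE =
     {{(1, i), (0, j)} |i j. i \<in> {1..N} \<and> j \<in> {1..N} \<and> nmE i j = 1} \<union> nsets (side N 1) 2"

end

theory Submission
  imports Defs
begin

text \<open>
  Write \<open>d = 1/2 - \<epsilon>\<close>, and let \<open>x\<close> be the number of vertices that \<open>\<pi>\<close> moves to the other
  side. Every vertex of the clique side has degree at least \<open>d N\<close> above that of every vertex of
  the independent side, so each side-changing vertex costs about \<open>d N\<close> edges. The side-preserving
  part of \<open>\<pi>\<close> extends to permutations \<open>f\<close>, \<open>g\<close> of the two sides, at the price of at most \<open>x N\<close>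
  pairs. If \<open>g\<close> moves few points, then \<open>nmE i j \<noteq> nmE (f i) (g j)\<close> holds for many \<open>j\<close> in each row
  \<open>i\<close> moved by \<open>f\<close>, by quasi-orthogonality, and symmetrically. If both move more than \<open>d N / 2\<close>
  points, then each agrees with a derangement at all of its moved points but one, and
  non-malleability for uniform sources on these points makes a \<open>d\<close> fraction of the pairs mismatch.
  Both bounds together cover all sizes of \<open>x\<close>.
\<close>

section \<open>Completing and perturbing permutations of a finite set\<close>

text \<open>An injection misses as many points with its domain as with its image, so any bijection
  between the leftovers completes it. This turns the side-preserving part of a vertex permutation
  into a permutation of one side.\<close>

lemma permutes_extending:
  assumes "finite S" "A \<subseteq> S" "inj_on h A" "h ` A \<subseteq> S"
  obtains f where "f permutes S" "\<And>x. x \<in> A \<Longrightarrow> f x = h x"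
proof -
  have "card (S - A) = card (S - h ` A)"
    unfolding card_Diff_subset[OF finite_subset[OF assms(2,1)] assms(2)]
      card_Diff_subset[OF finite_subset[OF assms(4,1)] assms(4)] card_image[OF assms(3)] ..
  then obtain r where r: "bij_betw r (S - A) (S - h ` A)"
    using finite_same_card_bij[of "S - A" "S - h ` A"] assms(1) by auto
  define f where "f = (\<lambda>x. if x \<in> A then h x else if x \<in> S then r x else x)"
  have "bij_betw f A (h ` A)"
    using assms(3) unfolding bij_betw_def f_def by (auto simp: inj_on_def)
  moreover have "bij_betw f (S - A) (S - h ` A)"
    using r by (rule iffD1[OF bij_betw_cong, rotated]) (auto simp: f_def)
  ultimately have "bij_betw f (A \<union> (S - A)) (h ` A \<union> (S - h ` A))"
    by (rule bij_betw_combine) auto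
  then have "bij_betw f S S"
    using assms(2,4) by (simp add: Un_absorb1)
  then have "f permutes S"
    using assms(2) by (intro bij_imp_permutes) (auto simp: f_def)
  then show ?thesis by (rule that) (simp add: f_def)
qed

text \<open>An exceptional point \<open>s\<close> is unavoidable: if \<open>f\<close> has exactly
  one fixed point, a permutation of \<open>S\<close> agreeing with \<open>f\<close> at all moved
  points fixes it as well. Letting the cycle of \<open>s\<close> absorb the fixed points one at a
  time confines the changes at moved points to \<open>s\<close>.\<close>

lemma permutes_derangement_off_point:
  assumes "finite S" "f permutes S" "s \<in> S" "f s \<noteq> s"
  obtains h where "h permutes S" "\<And>x. x \<in> S \<Longrightarrow> h x \<noteq> x"
    "\<And>x. f x \<noteq> x \<Longrightarrow> x \<noteq> s \<Longrightarrow> h x = f x"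
proof -
  have "\<exists>h. h permutes S \<and> (\<forall>x\<in>S. h x \<noteq> x) \<and> (\<forall>x. f x \<noteq> x \<longrightarrow> x \<noteq> s \<longrightarrow> h x = f x)"
    using assms(2,4)
  proof (induction "card {x\<in>S. f x = x}" arbitrary: f)
    case 0
    then show ?case using assms(1) by auto
  next
    case (Suc n)
    then obtain z where z: "z \<in> S" "f z = z"
      by (metis (mono_tags, lifting) card.empty empty_Collect_eq nat.distinct(1))
    \<comment> \<open>Splice the fixed point \<open>z\<close> into the cycle of \<open>s\<close>, directly after \<open>s\<close>.\<close>
    define h where "h = f \<circ> Transposition.transpose z s"
    have zs: "z \<noteq> s" using z Suc.prems by auto
    have hv: "h z = f s" "h s = z" "\<And>x. x \<noteq> z \<Longrightarrow> x \<noteq> s \<Longrightarrow> h x = f x"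
      using z by (simp_all add: h_def)
    have h: "h permutes S"
      unfolding h_def using Suc.prems(1) z(1) assms(3)
      by (intro permutes_compose permutes_swap_id)
    \<comment> \<open>\<open>z\<close> is its own image, so \<open>f s\<close> is another point.
      Hence \<open>h\<close> moves \<open>z\<close>, still moves \<open>s\<close>, and has exactly
      one fixed point fewer.\<close>
    have "f s \<noteq> z"
      using permutes_inj[OF Suc.prems(1)] z(2) zs by (metis injD)
    then have "{x\<in>S. h x = x} = {x\<in>S. f x = x} - {z}"
      using hv zs Suc.prems(2) by auto metis+
    then have "n = card {x\<in>S. h x = x}"
      using Suc.hyps(2) z assms(1) by simp
    moreover have "h s \<noteq> s" using hv zs by simp
    ultimately obtain h' where
      h': "h' permutes S" "\<forall>x\<in>S. h' x \<noteq> x" "\<forall>x. h x \<noteq> x \<longrightarrow> x \<noteq> s \<longrightarrow> h' x = h x"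
      using Suc.hyps(1) h by blast
    have "h' x = f x" if "f x \<noteq> x" "x \<noteq> s" for x
      using h'(3) hv(3)[of x] that z by metis
    then show ?case using h' by blast
  qed
  then show ?thesis using that by blast
qed

section \<open>Adjacency changes and degrees in an arbitrary graph\<close>

lemma card_diff_le_card_disagree:
  assumes "finite V"
  shows "\<bar>real (card {v\<in>V. P v}) - real (card {v\<in>V. Q v})\<bar> \<le> real (card {v\<in>V. P v \<noteq> Q v})"
proof -
  have "card {v\<in>V. P v} \<le> card ({v\<in>V. Q v} \<union> {v\<in>V. P v \<noteq> Q v})"
    "card {v\<in>V. Q v} \<le> card ({v\<in>V. P v} \<union> {v\<in>V. P v \<noteq> Q v})"
    by (rule card_mono; use assms in auto)+
  then have "card {v\<in>V. P v} \<le> card {v\<in>V. Q v} + card {v\<in>V. P v \<noteq> Q v}"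
    "card {v\<in>V. Q v} \<le> card {v\<in>V. P v} + card {v\<in>V. P v \<noteq> Q v}"
    by (meson card_Un_le order_trans)+
  then show ?thesis by linarith
qed

text \<open>Ordered pairs let the count be split over the first coordinate; compared with counting
  edges, this costs a factor of at most two.\<close>

definition distorted :: "'v set \<Rightarrow> 'v set set \<Rightarrow> ('v \<Rightarrow> 'v) \<Rightarrow> ('v \<times> 'v) set" where
  "distorted V E \<pi> = {(u, v) \<in> V \<times> V. ({u, v} \<in> E) \<noteq> ({\<pi> u, \<pi> v} \<in> E)}"

lemma finite_distorted: "finite V \<Longrightarrow> finite (distorted V E \<pi>)"
  by (rule finite_subset[of _ "V \<times> V"]) (auto simp: distorted_def)

text \<open>A distorted pair \<open>(u, v)\<close> is charged to \<open>{\<pi> u, \<pi> v}\<close>,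
  which is an image edge iff \<open>{u, v}\<close> is an edge and therefore lies in the symmetric
  difference. By injectivity of \<open>\<pi>\<close>, only the two orientations of a pair share a
  charge.\<close>

lemma card_distorted_le:
  assumes "finite V" "E \<subseteq> Pow V" "\<pi> permutes V"
  shows "card (distorted V E \<pi>) \<le> 2 * card (sym_diff E {{\<pi> u, \<pi> v} |u v. {u, v} \<in> E})"
    (is "_ \<le> 2 * card ?S")
proof -
  have inj: "\<pi> a = \<pi> b \<longleftrightarrow> a = b" for a b
    by (rule inj_eq[OF permutes_inj[OF assms(3)]])
  have image_edge: "{\<pi> u, \<pi> v} \<in> {{\<pi> u, \<pi> v} |u v. {u, v} \<in> E} \<longleftrightarrow> {u, v} \<in> E" for u v
  proof
    assume "{\<pi> u, \<pi> v} \<in> {{\<pi> u, \<pi> v} |u v. {u, v} \<in> E}"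
    then obtain a b where "{\<pi> u, \<pi> v} = {\<pi> a, \<pi> b}" "{a, b} \<in> E" by blast
    then show "{u, v} \<in> E" by (metis doubleton_eq_iff inj)
  qed blast
  then have sub: "distorted V E \<pi> \<subseteq> (\<Union>e\<in>?S. {(u, v). {\<pi> u, \<pi> v} = e})"
  proof clarify
    fix u v
    assume "(u, v) \<in> distorted V E \<pi>"
    then have "{\<pi> u, \<pi> v} \<in> ?S"
      unfolding distorted_def using image_edge[of u v] by auto
    then show "(u, v) \<in> (\<Union>e\<in>?S. {(u, v). {\<pi> u, \<pi> v} = e})" by simp
  qed
  have fib: "finite {(u, v). {\<pi> u, \<pi> v} = e} \<and> card {(u, v). {\<pi> u, \<pi> v} = e} \<le> 2" for e
  proof (cases "\<exists>u v. e = {\<pi> u, \<pi> v}")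
    case True
    then obtain a b where e: "e = {\<pi> a, \<pi> b}" by blast
    have sub: "{(u, v). {\<pi> u, \<pi> v} = e} \<subseteq> {(a, b), (b, a)}"
      by (auto simp: e doubleton_eq_iff inj)
    have "card {(a, b), (b, a)} \<le> 2" by (rule card_insert_le_m1) simp_all
    with card_mono[OF _ sub] have "card {(u, v). {\<pi> u, \<pi> v} = e} \<le> 2"
      by (meson finite.emptyI finite_insert order_trans)
    moreover have "finite {(u, v). {\<pi> u, \<pi> v} = e}" by (rule finite_subset[OF sub]) simp
    ultimately show ?thesis by simp
  next
    case False
    then have "{(u, v). {\<pi> u, \<pi> v} = e} = {}" by auto
    then show ?thesis by (metis card.empty finite.emptyI zero_le)
  qed
  have "?S \<subseteq> Pow V"
  proof -
    have "{\<pi> u, \<pi> v} \<subseteq> V" if "{u, v} \<in> E" for u v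
      using that assms(2) permutes_in_image[OF assms(3)] by auto
    then have "{{\<pi> u, \<pi> v} |u v. {u, v} \<in> E} \<subseteq> Pow V" by blast
    then show ?thesis using assms(2) by (meson Diff_subset Un_least order_trans)
  qed
  then have fin: "finite ?S" by (rule finite_subset) (simp add: assms(1))
  have "card (distorted V E \<pi>) \<le> card (\<Union>e\<in>?S. {(u, v). {\<pi> u, \<pi> v} = e})"
    by (rule card_mono[OF finite_UN_I[OF fin] sub]) (simp add: fib)
  also have "\<dots> \<le> (\<Sum>e\<in>?S. card {(u, v). {\<pi> u, \<pi> v} = e})"
    by (rule card_UN_le[OF fin])
  also have "\<dots> \<le> card ?S * 2"
    using sum_bounded_above[of ?S "\<lambda>e. card {(u, v). {\<pi> u, \<pi> v} = e}" 2] fib by simp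
  finally show ?thesis by simp
qed

text \<open>Reindexing by \<open>\<pi>\<close>, the degree of \<open>\<pi> u\<close> counts the
  \<open>v\<close> with \<open>{\<pi> u, \<pi> v}\<close> in \<open>E\<close>. It therefore differs
  from the degree of \<open>u\<close> by at most the number of distorted pairs starting at
  \<open>u\<close>; these are summed over \<open>C\<close>.\<close>

lemma degree_gap_le_card_distorted:
  assumes "finite V" "\<pi> permutes V" "C \<subseteq> V"
    and gap: "\<And>u. u \<in> C \<Longrightarrow>
      d \<le> \<bar>real (card {v\<in>V. {u, v} \<in> E}) - real (card {v\<in>V. {\<pi> u, v} \<in> E})\<bar>"
  shows "d * real (card C) \<le> real (card (distorted V E \<pi>))"
proof -
  let ?D = "\<lambda>u. {v\<in>V. ({u, v} \<in> E) \<noteq> ({\<pi> u, \<pi> v} \<in> E)}"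
  have d: "d \<le> real (card (?D u))" if "u \<in> C" for u
  proof -
    have "bij_betw \<pi> {v\<in>V. {\<pi> u, \<pi> v} \<in> E} {v\<in>V. {\<pi> u, v} \<in> E}"
      unfolding bij_betw_def
    proof
      show "inj_on \<pi> {v\<in>V. {\<pi> u, \<pi> v} \<in> E}"
        using permutes_inj[OF assms(2)] by (rule inj_on_subset) simp
      show "\<pi> ` {v\<in>V. {\<pi> u, \<pi> v} \<in> E} = {v\<in>V. {\<pi> u, v} \<in> E}"
        using permutes_image[OF assms(2)] by auto
    qed
    then have "card {v\<in>V. {\<pi> u, \<pi> v} \<in> E} = card {v\<in>V. {\<pi> u, v} \<in> E}"
      by (rule bij_betw_same_card)
    then show ?thesis
      using gap[OF that] card_diff_le_card_disagree[OF assms(1),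
          of "\<lambda>v. {u, v} \<in> E" "\<lambda>v. {\<pi> u, \<pi> v} \<in> E"] by linarith
  qed
  have fC: "finite C" using assms finite_subset by blast
  have "d * real (card C) \<le> (\<Sum>u\<in>C. real (card (?D u)))"
    using sum_mono[of C "\<lambda>_. d" "\<lambda>u. real (card (?D u))"] d by (simp add: mult.commute)
  also have "\<dots> = real (card (SIGMA u:C. ?D u))"
    using assms(1) fC by simp
  also have "\<dots> \<le> real (card (distorted V E \<pi>))"
    using assms(1,3) by (intro of_nat_mono card_mono finite_distorted) (auto simp: distorted_def)
  finally show ?thesis .
qed

section \<open>Mismatches between a two-argument function and its permuted copy\<close>

definition mismatches :: "'a set \<Rightarrow> ('a \<Rightarrow> 'a \<Rightarrow> 'b) \<Rightarrow> ('a \<Rightarrow> 'a) \<Rightarrow> ('a \<Rightarrow> 'a) \<Rightarrow> ('a \<times> 'a) set" where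
  "mismatches S M f g = {(i, j) \<in> S \<times> S. M i j \<noteq> M (f i) (g j)}"

lemma finite_mismatches: "finite S \<Longrightarrow> finite (mismatches S M f g)"
  by (rule finite_subset[of _ "S \<times> S"]) (auto simp: mismatches_def)

lemma card_mismatches_swap:
  "card (mismatches S (\<lambda>i j. M j i) g f) = card (mismatches S M f g)"
proof -
  have "mismatches S (\<lambda>i j. M j i) g f = prod.swap ` mismatches S M f g"
    by (auto simp: mismatches_def image_iff)
  then show ?thesis by (metis card_image inj_swap inj_on_subset subset_UNIV)
qed

text \<open>In a row \<open>x\<close> moved by \<open>f\<close>, every column fixed by
  \<open>g\<close> in which the rows \<open>x\<close> and \<open>f x\<close> differ is a mismatch.
  At most the columns moved by \<open>g\<close> are lost from the guaranteed
  \<open>d\<close>.\<close>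

lemma mismatches_ge_of_rows:
  assumes "finite S" "f permutes S"
    and rows: "\<And>x x'. x \<in> S \<Longrightarrow> x' \<in> S \<Longrightarrow> x \<noteq> x' \<Longrightarrow> d \<le> real (card {y\<in>S. M x y \<noteq> M x' y})"
  shows "real (card {x\<in>S. f x \<noteq> x}) * (d - real (card {y\<in>S. g y \<noteq> y}))
    \<le> real (card (mismatches S M f g))"
proof -
  let ?P = "{x\<in>S. f x \<noteq> x}" and ?Q = "{y\<in>S. g y \<noteq> y}"
  let ?D = "\<lambda>x. {y\<in>S. M x y \<noteq> M (f x) y} - ?Q"
  have d: "d - real (card ?Q) \<le> real (card (?D x))" if "x \<in> ?P" for x
  proof -
    have "d \<le> real (card {y\<in>S. M x y \<noteq> M (f x) y})"
      using rows[of x "f x"] that permutes_in_image[OF assms(2)] by auto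
    moreover have "card {y\<in>S. M x y \<noteq> M (f x) y} - card ?Q \<le> card (?D x)"
      using assms(1) by (intro diff_card_le_card_Diff) auto
    ultimately show ?thesis by linarith
  qed
  have "real (card ?P) * (d - real (card ?Q)) \<le> (\<Sum>x\<in>?P. real (card (?D x)))"
    using sum_mono[of ?P "\<lambda>_. d - real (card ?Q)" "\<lambda>x. real (card (?D x))"] d by simp
  also have "\<dots> = real (card (SIGMA x:?P. ?D x))"
    using assms(1) by simp
  also have "\<dots> \<le> real (card (mismatches S M f g))"
    using assms(1) by (intro of_nat_mono card_mono finite_mismatches) (auto simp: mismatches_def)
  finally show ?thesis .
qed

text \<open>Small bias makes the two outputs differ with probability close to 1/2. The marginals of
  the tampered output cancel once the absolute values are opened with suitable signs.\<close>

lemma nm_bias_mismatch_prob: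
  assumes "set_pmf X \<subseteq> S" "set_pmf Y \<subseteq> S" "f ` S \<subseteq> S" "g ` S \<subseteq> S"
    and M: "\<And>x y. x \<in> S \<Longrightarrow> y \<in> S \<Longrightarrow> M x y \<in> {0, 1}"
  shows "1 / 2 - nm_bias M X Y f g
    \<le> measure_pmf.prob (pair_pmf X Y) {(x, y). M x y \<noteq> M (f x) (g y)}"
proof -
  let ?p = "measure_pmf.prob (pair_pmf X Y)"
  define P where "P \<alpha> \<beta> = ?p {(x, y). (M x y, M (f x) (g y)) = (\<alpha>, \<beta>)}" for \<alpha> \<beta>
  define q where "q \<beta> = ?p {(x, y). M (f x) (g y) = \<beta>}" for \<beta>
  have bin: "M x y \<in> {0, 1}" "M (f x) (g y) \<in> {0, 1}" if "(x, y) \<in> set_pmf (pair_pmf X Y)" for x y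
    using that assms(1-4) by (intro M; force)+
  \<comment> \<open>Decompositions are required only on the support, since \<open>M\<close> is known
    to be binary only on \<open>S\<close>.\<close>
  have add: "?p A = ?p B + ?p C"
    if "B \<inter> C = {}" "A \<inter> set_pmf (pair_pmf X Y) = (B \<union> C) \<inter> set_pmf (pair_pmf X Y)" for A B C
  proof -
    have "?p A = ?p (B \<union> C)"
      using that(2) measure_Int_set_pmf by metis
    then show ?thesis using that(1) by (simp add: measure_pmf.finite_measure_Union)
  qed
  have ne: "?p {(x, y). M x y \<noteq> M (f x) (g y)} = P 0 1 + P 1 0"
    unfolding P_def by (rule add) (use bin in fastforce)+
  have q: "q \<beta> = P 0 \<beta> + P 1 \<beta>" for \<beta>
    unfolding P_def q_def by (rule add) (use bin in fastforce)+
  have "?p UNIV = q 0 + q 1"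
    unfolding q_def by (rule add) (use bin in fastforce)+
  then have "q 0 + q 1 = 1" by simp
  moreover have "nm_bias M X Y f g = 1 / 2 * (\<bar>P 0 0 - 1 / 2 * q 0\<bar> + \<bar>P 0 1 - 1 / 2 * q 1\<bar>
      + (\<bar>P 1 0 - 1 / 2 * q 0\<bar> + \<bar>P 1 1 - 1 / 2 * q 1\<bar>))"
    unfolding nm_bias_def P_def q_def by simp
  \<comment> \<open>Taking sign plus on the two equal-output terms and minus on the two unequal ones
    bounds the bias below by \<open>1/2 * (P 0 0 + P 1 1 - P 0 1 - P 1 0)\<close>, which is 1/2
    minus the mismatch probability.\<close>
  ultimately show ?thesis
    using ne q[of 0] q[of 1] abs_ge_self[of "P 0 0 - 1 / 2 * q 0"] abs_ge_self[of "P 1 1 - 1 / 2 * q 1"]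
      abs_ge_minus_self[of "P 0 1 - 1 / 2 * q 1"] abs_ge_minus_self[of "P 1 0 - 1 / 2 * q 0"]
    by argo
qed

lemma is_source_pmf_of_set:
  assumes "A \<subseteq> {1..N}" "A \<noteq> {}" "2 powr k \<le> real (card A)"
  shows "is_source N k (pmf_of_set A)"
proof -
  have fin: "finite A" using assms(1) finite_subset by blast
  have "pmf (pmf_of_set A) x \<le> 2 powr (- k)" for x
  proof -
    have "pmf (pmf_of_set A) x \<le> 1 / real (card A)"
      using fin assms(2) by (simp add: pmf_of_set indicator_def)
    also have "\<dots> \<le> 1 / 2 powr k"
      using fin assms(2,3) by (intro divide_left_mono) (simp_all add: card_gt_0_iff)
    finally show ?thesis by (simp add: powr_minus_divide)
  qed
  then show ?thesis unfolding is_source_def using fin assms by simp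
qed

lemma pair_pmf_of_set:
  assumes "finite A" "A \<noteq> {}" "finite B" "B \<noteq> {}"
  shows "pair_pmf (pmf_of_set A) (pmf_of_set B) = pmf_of_set (A \<times> B)"
proof (rule pmf_eqI)
  fix z :: "'a \<times> 'b"
  show "pmf (pair_pmf (pmf_of_set A) (pmf_of_set B)) z = pmf (pmf_of_set (A \<times> B)) z"
    using assms by (cases z) (simp add: pmf_pair indicator_def)
qed

text \<open>For uniform sources on \<open>A\<close> and \<open>B\<close> the size bounds supply the
  min-entropy, and the mismatch probability is the density of mismatches in the rectangle
  \<open>A \<times> B\<close>.\<close>

lemma mismatches_ge_of_derangements:
  assumes nm: "nm_two_source_extractor_perm N k \<epsilon> M"
    and M: "\<And>x y. x \<in> {1..N} \<Longrightarrow> y \<in> {1..N} \<Longrightarrow> M x y \<in> {0, 1}"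
    and f: "f permutes {1..N}" "\<And>x. x \<in> {1..N} \<Longrightarrow> f x \<noteq> x"
    and g: "g permutes {1..N}" "\<And>x. x \<in> {1..N} \<Longrightarrow> g x \<noteq> x"
    and A: "A \<subseteq> {1..N}" "A \<noteq> {}" "2 powr k \<le> real (card A)"
    and B: "B \<subseteq> {1..N}" "B \<noteq> {}" "2 powr k \<le> real (card B)"
  shows "(1 / 2 - \<epsilon>) * (real (card A) * real (card B))
    \<le> real (card (mismatches {1..N} M f g \<inter> A \<times> B))"
proof -
  have fin: "finite A" "finite B" using A B finite_subset by blast+
  let ?X = "pmf_of_set A" and ?Y = "pmf_of_set B"
  have "nm_bias M ?X ?Y f g \<le> \<epsilon>"
    using nm f g is_source_pmf_of_set[OF A] is_source_pmf_of_set[OF B]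
    unfolding nm_two_source_extractor_perm_def nm_extractor_against_def by blast
  moreover have "1 / 2 - nm_bias M ?X ?Y f g
      \<le> measure_pmf.prob (pair_pmf ?X ?Y) {(x, y). M x y \<noteq> M (f x) (g y)}"
    using fin A B M permutes_image[OF f(1)] permutes_image[OF g(1)]
    by (intro nm_bias_mismatch_prob[where S = "{1..N}"]) simp_all
  ultimately have "1 / 2 - \<epsilon>
      \<le> measure_pmf.prob (pair_pmf ?X ?Y) {(x, y). M x y \<noteq> M (f x) (g y)}"
    by linarith
  also have "\<dots> = real (card (A \<times> B \<inter> {(x, y). M x y \<noteq> M (f x) (g y)})) / real (card (A \<times> B))"
    using fin A(2) B(2) by (simp add: pair_pmf_of_set measure_pmf_of_set)
  also have "A \<times> B \<inter> {(x, y). M x y \<noteq> M (f x) (g y)} = mismatches {1..N} M f g \<inter> A \<times> B"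
    using A(1) B(1) by (auto simp: mismatches_def)
  finally show ?thesis
    using fin A(2) B(2) by (simp add: pos_le_divide_eq card_gt_0_iff)
qed

text \<open>A permutation that moves \<open>s\<close> also moves \<open>f s\<close>, so at least two
  points are moved, and discarding the exceptional point \<open>s\<close> keeps at least half of
  them.\<close>

lemma permutes_derangement_half:
  assumes "finite S" "f permutes S" "{x\<in>S. f x \<noteq> x} \<noteq> {}"
  obtains h A where "h permutes S" "\<And>x. x \<in> S \<Longrightarrow> h x \<noteq> x" "A \<subseteq> S" "A \<noteq> {}"
    "\<And>x. x \<in> A \<Longrightarrow> h x = f x" "real (card {x\<in>S. f x \<noteq> x}) / 2 \<le> real (card A)"
proof -
  let ?P = "{x\<in>S. f x \<noteq> x}"
  obtain s where s: "s \<in> S" "f s \<noteq> s" using assms(3) by blast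
  obtain h where h: "h permutes S" "\<And>x. x \<in> S \<Longrightarrow> h x \<noteq> x"
    "\<And>x. f x \<noteq> x \<Longrightarrow> x \<noteq> s \<Longrightarrow> h x = f x"
    using permutes_derangement_off_point[OF assms(1,2) s] by blast
  have "f s \<in> ?P"
    using s permutes_in_image[OF assms(2)] inj_eq[OF permutes_inj[OF assms(2)], of "f s" s] by auto
  then have ne: "?P - {s} \<noteq> {}" using s(2) by blast
  have "card ?P = Suc (card (?P - {s}))"
    by (rule card.remove) (use assms(1) s in auto)
  moreover have "card (?P - {s}) \<ge> 1"
    using ne assms(1) by (simp add: Suc_le_eq card_gt_0_iff del: Diff_eq_empty_iff)
  ultimately have "real (card ?P) / 2 \<le> real (card (?P - {s}))" by simp
  then show ?thesis
    using h ne by (intro that[of h "?P - {s}"]) auto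
qed

lemma mismatches_ge_moved:
  assumes "0 < \<epsilon>" "\<epsilon> < 1 / 2"
    and k: "2 powr k \<le> (1 / 2 - \<epsilon>) * real N / 4"
    and M: "\<And>x y. x \<in> {1..N} \<Longrightarrow> y \<in> {1..N} \<Longrightarrow> M x y \<in> {0, 1}"
    and qo: "quasi_orthogonal N \<epsilon> M"
    and nm: "nm_two_source_extractor_perm N k \<epsilon> M"
    and f: "f permutes {1..N}" and g: "g permutes {1..N}"
  shows "(1 / 2 - \<epsilon>)\<^sup>2 / 16 * real N
      * (real (card {x\<in>{1..N}. f x \<noteq> x}) + real (card {y\<in>{1..N}. g y \<noteq> y}))
    \<le> real (card (mismatches {1..N} M f g))"
proof -
  define d where "d = 1 / 2 - \<epsilon>"
  define p where "p = real (card {x\<in>{1..N}. f x \<noteq> x})"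
  define q where "q = real (card {y\<in>{1..N}. g y \<noteq> y})"
  define D where "D = real (card (mismatches {1..N} M f g))"
  have d: "0 < d" "d \<le> 1" using assms(1,2) by (simp_all add: d_def)
  have pq: "0 \<le> p" "0 \<le> q" by (simp_all add: p_def q_def)
  have row: "p * (d * real N - q) \<le> D"
    unfolding p_def q_def D_def
    by (rule mismatches_ge_of_rows[OF _ f]) (use qo in \<open>auto simp: quasi_orthogonal_def d_def\<close>)
  have col: "q * (d * real N - p) \<le> D"
    unfolding p_def q_def D_def
    by (subst card_mismatches_swap[symmetric], rule mismatches_ge_of_rows[OF _ g])
      (use qo in \<open>auto simp: quasi_orthogonal_def d_def\<close>)
  \<comment> \<open>When \<open>p\<close> or \<open>q\<close> is small, the factor
    \<open>d / 4\<close> is available; the weaker \<open>d^2 / 16\<close> is what remains when both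
    are large.\<close>
  have small: "d\<^sup>2 / 16 * real N * (p + q) \<le> D" if "d * real N / 4 * (p + q) \<le> D"
  proof -
    have "d\<^sup>2 / 16 \<le> d / 4" using d by (simp add: power2_eq_square)
    then have "d\<^sup>2 / 16 * (real N * (p + q)) \<le> d / 4 * (real N * (p + q))"
      using pq by (intro mult_right_mono) auto
    also have "\<dots> \<le> D" using that by simp
    finally show ?thesis by (simp only: mult.assoc)
  qed
  \<comment> \<open>In the first four cases the smaller of \<open>p\<close> and \<open>q\<close> is
    at most \<open>d N / 2\<close>. Of \<open>row\<close> and \<open>col\<close>, the one led by the
    larger quantity gives at least that quantity times \<open>d N / 2\<close>, and twice the larger
    is at least \<open>p + q\<close>.\<close>
  consider "q \<le> d * real N / 2" "p \<le> q" | "p \<le> d * real N / 2" "q \<le> p"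
    | "q \<le> d * real N / 2" "q \<le> p" | "p \<le> d * real N / 2" "p \<le> q"
    | "d * real N / 2 < p" "d * real N / 2 < q" by linarith
  then have "d\<^sup>2 / 16 * real N * (p + q) \<le> D"
  proof cases
    case 1
    have "q * (d * real N / 2) \<le> q * (d * real N - p)"
      using 1 pq by (intro mult_left_mono) auto
    moreover have "d * real N / 4 * (p + q) \<le> d * real N / 4 * (q + q)"
      using 1 d by (intro mult_left_mono) auto
    ultimately show ?thesis using col by (intro small) (simp add: algebra_simps)
  next
    case 2
    have "p * (d * real N / 2) \<le> p * (d * real N - q)"
      using 2 pq by (intro mult_left_mono) auto
    moreover have "d * real N / 4 * (p + q) \<le> d * real N / 4 * (p + p)"
      using 2 d by (intro mult_left_mono) auto
    ultimately show ?thesis using row by (intro small) (simp add: algebra_simps)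
  next
    case 3
    have "p * (d * real N / 2) \<le> p * (d * real N - q)"
      using 3 pq by (intro mult_left_mono) auto
    moreover have "d * real N / 4 * (p + q) \<le> d * real N / 4 * (p + p)"
      using 3 d by (intro mult_left_mono) auto
    ultimately show ?thesis using row by (intro small) (simp add: algebra_simps)
  next
    case 4
    have "q * (d * real N / 2) \<le> q * (d * real N - p)"
      using 4 pq by (intro mult_left_mono) auto
    moreover have "d * real N / 4 * (p + q) \<le> d * real N / 4 * (q + q)"
      using 4 d by (intro mult_left_mono) auto
    ultimately show ?thesis using col by (intro small) (simp add: algebra_simps)
  next
    case 5
    have dN: "0 \<le> d * real N / 2" using d by simp
    have "0 < p" "0 < q" using 5 dN by linarith+
    then have moved: "{x\<in>{1..N}. f x \<noteq> x} \<noteq> {}" "{y\<in>{1..N}. g y \<noteq> y} \<noteq> {}"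
      unfolding p_def q_def by (metis card.empty of_nat_0 less_irrefl)+
    obtain f' A where A: "f' permutes {1..N}" "\<And>x. x \<in> {1..N} \<Longrightarrow> f' x \<noteq> x" "A \<subseteq> {1..N}"
      "A \<noteq> {}" "\<And>x. x \<in> A \<Longrightarrow> f' x = f x" "p / 2 \<le> real (card A)"
      using permutes_derangement_half[OF _ f moved(1)] unfolding p_def by auto
    obtain g' B where B: "g' permutes {1..N}" "\<And>x. x \<in> {1..N} \<Longrightarrow> g' x \<noteq> x" "B \<subseteq> {1..N}"
      "B \<noteq> {}" "\<And>x. x \<in> B \<Longrightarrow> g' x = g x" "q / 2 \<le> real (card B)"
      using permutes_derangement_half[OF _ g moved(2)] unfolding q_def by auto
    \<comment> \<open>The min-entropy threshold is met because \<open>d N / 4\<close> is below both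
      \<open>p / 2\<close> and \<open>q / 2\<close>.\<close>
    have "2 powr k \<le> real (card A)" "2 powr k \<le> real (card B)"
      using k 5 A(6) B(6) unfolding d_def by linarith+
    then have "d * (real (card A) * real (card B))
        \<le> real (card (mismatches {1..N} M f' g' \<inter> A \<times> B))"
      unfolding d_def by (intro mismatches_ge_of_derangements[OF nm M]) (use A B in auto)
    also have "\<dots> \<le> D"
      unfolding D_def using A(5) B(5)
      by (intro of_nat_mono card_mono finite_mismatches) (auto simp: mismatches_def)
    finally have D: "d * (real (card A) * real (card B)) \<le> D" .
    have "d * (p / 2 * (q / 2)) \<le> d * (real (card A) * real (card B))"
      using A(6) B(6) pq d by (intro mult_left_mono mult_mono) auto
    with D have pq_le: "d * (p * q) \<le> 4 * D" by simp
    \<comment> \<open>Replacing either factor of \<open>p * q\<close> by its lower bound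
      \<open>d N / 2\<close> and averaging gives \<open>p * q \<ge> d N / 4 * (p + q)\<close>. The
      two halvings in \<open>A\<close> and \<open>B\<close> contribute the remaining factor
      1/4.\<close>
    have "d * real N / 2 * q \<le> p * q"
      using 5 pq by (intro mult_right_mono) auto
    moreover have "p * (d * real N / 2) \<le> p * q"
      using 5 pq by (intro mult_left_mono) auto
    ultimately have "d * (d * real N / 4 * (p + q)) \<le> d * (p * q)"
      using d by (intro mult_left_mono) (auto simp: algebra_simps)
    with pq_le show ?thesis by (simp add: power2_eq_square algebra_simps)
  qed
  then show ?thesis by (simp add: d_def p_def q_def D_def)
qed

section \<open>Adjacency and degrees in the graph built from \<open>M\<close>\<close>

lemma edge_side1_side1:
  "{(1, i), (1, i')} \<in> ext_graph_edges N M \<longleftrightarrow> i \<in> {1..N} \<and> i' \<in> {1..N} \<and> i \<noteq> i'"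
  by (auto simp: ext_graph_edges_def side_def doubleton_in_nsets_2 doubleton_eq_iff)

lemma edge_side1_side0:
  "{(1, i), (0, j)} \<in> ext_graph_edges N M \<longleftrightarrow> i \<in> {1..N} \<and> j \<in> {1..N} \<and> M i j = 1"
  by (auto simp: ext_graph_edges_def side_def doubleton_in_nsets_2 doubleton_eq_iff)

lemma edge_side0_side1:
  "{(0, j), (1, i)} \<in> ext_graph_edges N M \<longleftrightarrow> i \<in> {1..N} \<and> j \<in> {1..N} \<and> M i j = 1"
  using edge_side1_side0 by (simp add: insert_commute)

lemma edge_side0_side0: "{(0, j), (0, j')} \<notin> ext_graph_edges N M"
  by (auto simp: ext_graph_edges_def side_def doubleton_in_nsets_2 doubleton_eq_iff)

lemma finite_ext_graph_verts: "finite (ext_graph_verts N)"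
  by (simp add: ext_graph_verts_def side_def)

lemma ext_graph_edges_subset: "ext_graph_edges N M \<subseteq> Pow (ext_graph_verts N)"
  by (auto simp: ext_graph_edges_def ext_graph_verts_def side_def nsets_def)

lemma ext_graph_verts_cases:
  assumes "v \<in> ext_graph_verts N"
  obtains i where "v = (1, i)" "i \<in> {1..N}" | j where "v = (0, j)" "j \<in> {1..N}"
  using assms by (auto simp: ext_graph_verts_def side_def)

lemma card_ext_graph_verts_filter:
  "card {v\<in>ext_graph_verts N. P v} = card {i\<in>{1..N}. P (1, i)} + card {j\<in>{1..N}. P (0, j)}"
proof -
  have "{v\<in>ext_graph_verts N. P v} = Pair 1 ` {i\<in>{1..N}. P (1, i)} \<union> Pair 0 ` {j\<in>{1..N}. P (0, j)}"
    by (auto simp: ext_graph_verts_def side_def)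
  moreover have "card (Pair (1::nat) ` {i\<in>{1..N}. P (1, i)} \<union> Pair (0::nat) ` {j\<in>{1..N}. P (0, j)})
      = card (Pair (1::nat) ` {i\<in>{1..N}. P (1, i)}) + card (Pair (0::nat) ` {j\<in>{1..N}. P (0, j)})"
    by (rule card_Un_disjoint) auto
  ultimately show ?thesis by (simp add: card_image inj_on_def)
qed

lemma degree_side1:
  assumes "i \<in> {1..N}"
  shows "card {v\<in>ext_graph_verts N. {(1, i), v} \<in> ext_graph_edges N M}
    = N - 1 + card {j\<in>{1..N}. M i j = 1}"
proof -
  have "{i'\<in>{1..N}. {(1, i), (1, i')} \<in> ext_graph_edges N M} = {1..N} - {i}"
    "{j\<in>{1..N}. {(1, i), (0, j)} \<in> ext_graph_edges N M} = {j\<in>{1..N}. M i j = 1}"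
    unfolding edge_side1_side1 edge_side1_side0 using assms by auto
  then show ?thesis using assms by (simp only: card_ext_graph_verts_filter) simp
qed

lemma degree_side0:
  assumes "j \<in> {1..N}"
  shows "card {v\<in>ext_graph_verts N. {(0, j), v} \<in> ext_graph_edges N M} = card {i\<in>{1..N}. M i j = 1}"
proof -
  have "{i\<in>{1..N}. {(0, j), (1, i)} \<in> ext_graph_edges N M} = {i\<in>{1..N}. M i j = 1}"
    "{j'\<in>{1..N}. {(0, j), (0, j')} \<in> ext_graph_edges N M} = {}"
    unfolding edge_side0_side1 using assms edge_side0_side0 by auto
  then show ?thesis by (simp only: card_ext_graph_verts_filter) simp
qed

text \<open>Bounding the zeros of row \<open>i\<close> leaves at least
  \<open>(1/2 - \<epsilon>) N\<close> ones, which come on top of the \<open>N - 1\<close> clique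
  neighbours; the degree on the independent side stays below \<open>N\<close>.\<close>

lemma degree_gap:
  assumes "\<epsilon> < 1 / 2" and i: "i \<in> {1..N}" and j: "j \<in> {1..N}"
    and M: "\<And>x y. x \<in> {1..N} \<Longrightarrow> y \<in> {1..N} \<Longrightarrow> M x y \<in> {0, 1}"
    and qo: "quasi_orthogonal N \<epsilon> M"
  shows "(1 / 2 - \<epsilon>) * real N
    \<le> real (card {v\<in>ext_graph_verts N. {(1, i), v} \<in> ext_graph_edges N M})
      - real (card {v\<in>ext_graph_verts N. {(0, j), v} \<in> ext_graph_edges N M})"
proof -
  have N: "N \<ge> 1" using i by simp
  have "{1..N} = {j\<in>{1..N}. M i j = 0} \<union> {j\<in>{1..N}. M i j = 1}"
    using M[OF i] by blast
  then have "card {1..N} \<le> card {j\<in>{1..N}. M i j = 0} + card {j\<in>{1..N}. M i j = 1}"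
    by (rule ord_eq_le_trans[OF arg_cong[of _ _ card] card_Un_le])
  then have "N \<le> card {j\<in>{1..N}. M i j = 0} + card {j\<in>{1..N}. M i j = 1}"
    by (simp only: card_atLeastAtMost diff_Suc_1')
  moreover have "real (card {j\<in>{1..N}. M i j = 0}) \<le> (1 / 2 + \<epsilon>) * real N"
    "real (card {i\<in>{1..N}. M i j = 1}) \<le> (1 / 2 + \<epsilon>) * real N"
    using qo i j unfolding quasi_orthogonal_def by blast+
  \<comment> \<open>Strictness and integrality bound the column count by \<open>N - 1\<close>, which
    cancels the clique degree exactly, so no additive loss remains for small
    \<open>N\<close>.\<close>
  moreover have "(1 / 2 + \<epsilon>) * real N < real N"
    using assms(1) N by simp
  ultimately have "(1 / 2 - \<epsilon>) * real N \<le> real (card {j\<in>{1..N}. M i j = 1})"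
    and "card {i\<in>{1..N}. M i j = 1} \<le> N - 1"
    by (simp_all add: algebra_simps)
  then show ?thesis
    using N unfolding degree_side1[OF i] degree_side0[OF j] by linarith
qed

section \<open>Robust self-ordering of the graph\<close>

lemma ext_graph_robustly_self_ordered:
  assumes eps: "0 < \<epsilon>" "\<epsilon> < 1 / 2"
    and k: "2 powr k \<le> (1 / 2 - \<epsilon>) * real N / 4"
    and M: "\<And>x y. x \<in> {1..N} \<Longrightarrow> y \<in> {1..N} \<Longrightarrow> M x y \<in> {0, 1}"
    and qo: "quasi_orthogonal N \<epsilon> M"
    and nm: "nm_two_source_extractor_perm N k \<epsilon> M"
  shows "robustly_self_ordered ((1 / 2 - \<epsilon>) ^ 3 / 128 * (2 * real N))
    (ext_graph_verts N) (ext_graph_edges N M)"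
  unfolding robustly_self_ordered_def
proof (intro allI impI)
  fix \<pi>
  let ?V = "ext_graph_verts N" and ?E = "ext_graph_edges N M"
  assume \<pi>: "\<pi> permutes ?V"
  define d where "d = 1 / 2 - \<epsilon>"
  define C where "C = {v\<in>?V. fst (\<pi> v) \<noteq> fst v}"
  define x where "x = real (card C)"
  define R where "R = real (card (distorted ?V ?E \<pi>))"
  define t where "t = real (card {v\<in>?V. \<pi> v \<noteq> v})"
  have d: "0 < d" "d \<le> 1 / 2" using eps by (simp_all add: d_def)
  have \<pi>V: "\<pi> v \<in> ?V" if "v \<in> ?V" for v
    using that permutes_in_image[OF \<pi>] by simp
  have V: "(1, i) \<in> ?V" "(0, i) \<in> ?V" if "i \<in> {1..N}" for i
    using that by (auto simp: ext_graph_verts_def side_def)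

  have crossing: "x * (d * real N) \<le> R"
    unfolding x_def R_def mult.commute[of "real (card C)"]
  proof (rule degree_gap_le_card_distorted[OF finite_ext_graph_verts \<pi>])
    show "C \<subseteq> ?V" by (auto simp: C_def)
    fix u assume "u \<in> C"
    then have u: "u \<in> ?V" "fst (\<pi> u) \<noteq> fst u" by (auto simp: C_def)
    note gap = degree_gap[OF eps(2) _ _ M qo, folded d_def]
    show "d * real N \<le> \<bar>real (card {v\<in>?V. {u, v} \<in> ?E}) - real (card {v\<in>?V. {\<pi> u, v} \<in> ?E})\<bar>"
      using u(1)
    proof (cases rule: ext_graph_verts_cases)
      case (1 i)
      then obtain j where "\<pi> u = (0, j)" "j \<in> {1..N}"
        using \<pi>V[OF u(1)] u(2) by (elim ext_graph_verts_cases) simp_all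
      then show ?thesis using gap[of i j] 1 by simp
    next
      case (2 j)
      then obtain i where "\<pi> u = (1, i)" "i \<in> {1..N}"
        using \<pi>V[OF u(1)] u(2) by (elim ext_graph_verts_cases) simp_all
      then show ?thesis using gap[of i j] 2 by simp
    qed
  qed

  \<comment> \<open>On each side, the vertices that stay there are mapped injectively into that
    side; the values chosen at the others are arbitrary and are paid for in
    \<open>bip\<close>.\<close>
  have extend: "\<exists>f. f permutes {1..N} \<and>
      (\<forall>i\<in>{1..N}. fst (\<pi> (\<sigma>, i)) = \<sigma> \<longrightarrow> \<pi> (\<sigma>, i) = (\<sigma>, f i))" if \<sigma>: "\<sigma> \<in> {0, 1}" for \<sigma>
  proof -
    let ?A = "{i\<in>{1..N}. fst (\<pi> (\<sigma>, i)) = \<sigma>}"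
    have inj: "inj_on (\<lambda>i. snd (\<pi> (\<sigma>, i))) ?A"
    proof (rule inj_onI)
      fix i i' assume "i \<in> ?A" "i' \<in> ?A" "snd (\<pi> (\<sigma>, i)) = snd (\<pi> (\<sigma>, i'))"
      then have "\<pi> (\<sigma>, i) = \<pi> (\<sigma>, i')" by (simp add: prod_eq_iff)
      then show "i = i'" using permutes_inj[OF \<pi>] by (auto dest: injD)
    qed
    have img: "(\<lambda>i. snd (\<pi> (\<sigma>, i))) ` ?A \<subseteq> {1..N}"
    proof
      fix y assume "y \<in> (\<lambda>i. snd (\<pi> (\<sigma>, i))) ` ?A"
      then obtain i where i: "i \<in> ?A" "y = snd (\<pi> (\<sigma>, i))" by blast
      then have "\<pi> (\<sigma>, i) \<in> ?V" using \<sigma> V by (intro \<pi>V) auto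
      then show "y \<in> {1..N}" unfolding i(2) by (elim ext_graph_verts_cases) simp_all
    qed
    obtain f where "f permutes {1..N}" "\<And>i. i \<in> ?A \<Longrightarrow> f i = snd (\<pi> (\<sigma>, i))"
      by (rule permutes_extending[OF _ _ inj img]) auto
    then show ?thesis by (intro exI[of _ f]) (auto simp: prod_eq_iff)
  qed
  obtain f where f: "f permutes {1..N}"
    "\<And>i. i \<in> {1..N} \<Longrightarrow> fst (\<pi> (1, i)) = 1 \<Longrightarrow> \<pi> (1, i) = (1, f i)"
    using extend[of 1] by auto
  obtain g where g: "g permutes {1..N}"
    "\<And>j. j \<in> {1..N} \<Longrightarrow> fst (\<pi> (0, j)) = 0 \<Longrightarrow> \<pi> (0, j) = (0, g j)"
    using extend[of 0] by auto
  define p where "p = real (card {i\<in>{1..N}. f i \<noteq> i})"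
  define q where "q = real (card {j\<in>{1..N}. g j \<noteq> j})"
  define D where "D = real (card (mismatches {1..N} M f g))"
  let ?C1 = "{i\<in>{1..N}. fst (\<pi> (1, i)) \<noteq> 1}" and ?C0 = "{j\<in>{1..N}. fst (\<pi> (0, j)) \<noteq> 0}"
  have x: "x = real (card ?C1) + real (card ?C0)"
    unfolding x_def C_def card_ext_graph_verts_filter by simp

  \<comment> \<open>A mismatch whose row and column vertices both keep their side is a distorted
    pair. All others lie in a row of \<open>?C1\<close> or a column of \<open>?C0\<close>, at most
    \<open>x N\<close> pairs in total.\<close>
  have "card (mismatches {1..N} M f g)
      \<le> card ({(i, j). ((1, i), (0, j)) \<in> distorted ?V ?E \<pi>} \<union> (?C1 \<times> {1..N} \<union> {1..N} \<times> ?C0))"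
  proof (rule card_mono)
    have "finite {(i, j). ((1, i), (0, j)) \<in> distorted ?V ?E \<pi>}"
      by (rule finite_subset[of _ "{1..N} \<times> {1..N}"])
        (auto simp: distorted_def ext_graph_verts_def side_def)
    then show "finite ({(i, j). ((1, i), (0, j)) \<in> distorted ?V ?E \<pi>} \<union> (?C1 \<times> {1..N} \<union> {1..N} \<times> ?C0))"
      by simp
    show "mismatches {1..N} M f g
      \<subseteq> {(i, j). ((1, i), (0, j)) \<in> distorted ?V ?E \<pi>} \<union> (?C1 \<times> {1..N} \<union> {1..N} \<times> ?C0)"
    proof (intro subrelI UnCI)
      fix i j
      assume ij: "(i, j) \<in> mismatches {1..N} M f g"
        "(i, j) \<notin> ?C1 \<times> {1..N} \<union> {1..N} \<times> ?C0"
      then have i: "i \<in> {1..N}" "j \<in> {1..N}" "M i j \<noteq> M (f i) (g j)"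
        by (auto simp: mismatches_def)
      then have \<pi>ij: "\<pi> (1, i) = (1, f i)" "\<pi> (0, j) = (0, g j)"
        using ij(2) f(2) g(2) by auto
      have fg: "f i \<in> {1..N}" "g j \<in> {1..N}"
        using i permutes_in_image[OF f(1)] permutes_in_image[OF g(1)] by auto
      \<comment> \<open>Edges record only the value 1; since both values are binary, different
        values mean that exactly one of the two pairs is an edge.\<close>
      have "(M i j = 1) \<noteq> (M (f i) (g j) = 1)"
        using i(3) M[OF i(1,2)] M[OF fg] by auto
      then show "(i, j) \<in> {(i, j). ((1, i), (0, j)) \<in> distorted ?V ?E \<pi>}"
        unfolding distorted_def using i(1,2) fg V \<pi>ij edge_side1_side0[of _ _ N M] by auto
    qed
  qed
  also have "\<dots> \<le> card {(i, j). ((1, i), (0, j)) \<in> distorted ?V ?E \<pi>}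
      + (card (?C1 \<times> {1..N}) + card ({1..N} \<times> ?C0))"
    by (intro order_trans[OF card_Un_le] add_left_mono card_Un_le)
  also have "card {(i, j). ((1, i), (0, j)) \<in> distorted ?V ?E \<pi>} \<le> card (distorted ?V ?E \<pi>)"
    by (rule card_inj_on_le[where f = "\<lambda>(i, j). ((1, i), (0, j))"])
      (auto simp: inj_on_def intro: finite_distorted[OF finite_ext_graph_verts])
  finally have "real (card (mismatches {1..N} M f g))
      \<le> real (card (distorted ?V ?E \<pi>) + (card (?C1 \<times> {1..N}) + card ({1..N} \<times> ?C0)))"
    by (intro of_nat_mono) simp
  then have bip: "D \<le> R + x * real N"
    by (simp add: D_def R_def x card_cartesian_product algebra_simps)

  have D: "d\<^sup>2 / 16 * real N * (p + q) \<le> D"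
    unfolding d_def p_def q_def D_def by (rule mismatches_ge_moved[OF eps k M qo nm f(1) g(1)])

  \<comment> \<open>A vertex moved by \<open>\<pi>\<close> either changes side or is moved by
    \<open>f\<close> or \<open>g\<close> within its side, whence
    \<open>t - x \<le> p + q\<close>.\<close>
  have "{i\<in>{1..N}. \<pi> (1, i) \<noteq> (1, i)} \<subseteq> {i\<in>{1..N}. f i \<noteq> i} \<union> ?C1"
    using f(2) by (intro subsetI) (metis (mono_tags, lifting) UnCI mem_Collect_eq)
  then have "card {i\<in>{1..N}. \<pi> (1, i) \<noteq> (1, i)} \<le> card ({i\<in>{1..N}. f i \<noteq> i} \<union> ?C1)"
    by (intro card_mono) auto
  moreover have "{j\<in>{1..N}. \<pi> (0, j) \<noteq> (0, j)} \<subseteq> {j\<in>{1..N}. g j \<noteq> j} \<union> ?C0"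
    using g(2) by (intro subsetI) (metis (mono_tags, lifting) UnCI mem_Collect_eq)
  then have "card {j\<in>{1..N}. \<pi> (0, j) \<noteq> (0, j)} \<le> card ({j\<in>{1..N}. g j \<noteq> j} \<union> ?C0)"
    by (intro card_mono) auto
  ultimately have "card {v\<in>?V. \<pi> v \<noteq> v} \<le>
      (card {i\<in>{1..N}. f i \<noteq> i} + card ?C1) + (card {j\<in>{1..N}. g j \<noteq> j} + card ?C0)"
    unfolding card_ext_graph_verts_filter by (meson add_mono card_Un_le order_trans)
  then have t: "t - x \<le> p + q"
    unfolding t_def x p_def q_def by linarith

  define c where "c = d\<^sup>2 / 16"
  have c: "0 < c" "c \<le> 1 / 2"
    using d power_mono[of d 1 2] by (auto simp: c_def)
  have "c * real N * (t - x) \<le> c * real N * (p + q)"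
    using t c by (intro mult_left_mono) auto
  then have "c * real N * (t - x) \<le> R + x * real N"
    using D bip unfolding c_def by linarith
  \<comment> \<open>The factor \<open>d\<close> turns each \<open>x N\<close> into
    \<open>x * (d N)\<close>, which \<open>crossing\<close> bounds by \<open>R\<close>. This removes
    \<open>x\<close> without a case distinction on its size.\<close>
  then have "d * (c * real N * (t - x)) \<le> d * (R + x * real N)"
    using d by (intro mult_left_mono) auto
  then have "d * c * real N * t \<le> d * R + (1 + c) * (x * (d * real N))"
    by (simp add: algebra_simps)
  also have "\<dots> \<le> d * R + (1 + c) * R"
    using crossing c by (intro add_left_mono mult_left_mono) auto
  also have "\<dots> = (1 + d + c) * R" by (simp add: algebra_simps)
  also have "\<dots> \<le> 2 * R"
    using c d by (intro mult_right_mono) (auto simp: R_def)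
  finally have R: "d * c * real N * t \<le> 2 * R" .
  define \<Delta> where "\<Delta> = real (card (sym_diff ?E {{\<pi> u, \<pi> v} |u v. {u, v} \<in> ?E}))"
  have "R \<le> real (2 * card (sym_diff ?E {{\<pi> u, \<pi> v} |u v. {u, v} \<in> ?E}))"
    unfolding R_def
    by (rule of_nat_mono[OF card_distorted_le[OF finite_ext_graph_verts ext_graph_edges_subset \<pi>]])
  also have "\<dots> = 2 * \<Delta>"
    unfolding \<Delta>_def of_nat_mult of_nat_numeral ..
  \<comment> \<open>The constant collects \<open>d * c = d^3 / 16\<close>, a factor 1/2 from
    \<open>1 + d + c \<le> 2\<close>, another 1/2 from ordered pairs, and a last 1/2 from writing
    \<open>2 N\<close> for the number of vertices.\<close>
  finally have "d ^ 3 / 128 * (2 * real N) * t \<le> \<Delta>"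
    using R by (simp add: c_def power2_eq_square power3_eq_cube)
  then show "real (card (sym_diff ?E {{\<pi> u, \<pi> v} |u v. {u, v} \<in> ?E}))
      \<ge> (1 / 2 - \<epsilon>) ^ 3 / 128 * (2 * real N) * real (card {v\<in>?V. \<pi> v \<noteq> v})"
    unfolding d_def t_def \<Delta>_def .
qed

section \<open>Conclusion for both classes of tampering functions\<close>

lemma nm_extractor_against_antimono:
  "F \<subseteq> G \<Longrightarrow> nm_extractor_against G N k \<epsilon> M \<Longrightarrow> nm_extractor_against F N k \<epsilon> M"
  unfolding nm_extractor_against_def by (intro allI impI ballI) (simp add: subset_iff)

text \<open>Permutations of \<open>{1..N}\<close> are among the self-maps of \<open>{1..N}\<close>,
  so a single argument from the permutation version serves both claims, with the same
  constant.\<close>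

lemma nm_two_source_extractor_imp_perm:
  "nm_two_source_extractor N k \<epsilon> M \<Longrightarrow> nm_two_source_extractor_perm N k \<epsilon> M"
  unfolding nm_two_source_extractor_def nm_two_source_extractor_perm_def
  by (rule nm_extractor_against_antimono) (auto simp: permutes_in_image simp del: atLeastAtMost_iff)

theorem theorem8p3:
  fixes \<epsilon> :: real
  assumes "0 < \<epsilon>" and "\<epsilon> < 1 / 2"
  shows
    "(\<exists>c>0. \<forall>(l::real) (k::real) (N::nat) (nmE :: nat \<Rightarrow> nat \<Rightarrow> nat).
        real N = 2 powr l \<longrightarrow> k \<le> l \<longrightarrow> k \<le> l - 2 + log 2 (1 / 2 - \<epsilon>) \<longrightarrow>
        nmE \<in> {1..N} \<rightarrow> {1..N} \<rightarrow> {0, 1} \<longrightarrow>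
        quasi_orthogonal N \<epsilon> nmE \<longrightarrow>
        nm_two_source_extractor N k \<epsilon> nmE \<longrightarrow>
        robustly_self_ordered (c * 2 powr (l + 1)) (ext_graph_verts N) (ext_graph_edges N nmE))
     \<and>
     (\<exists>c>0. \<forall>(l::real) (k::real) (N::nat) (nmE :: nat \<Rightarrow> nat \<Rightarrow> nat).
        real N = 2 powr l \<longrightarrow> k \<le> l \<longrightarrow> k \<le> l - 2 + log 2 (1 / 2 - \<epsilon>) \<longrightarrow>
        nmE \<in> {1..N} \<rightarrow> {1..N} \<rightarrow> {0, 1} \<longrightarrow>
        quasi_orthogonal N \<epsilon> nmE \<longrightarrow>
        nm_two_source_extractor_perm N k \<epsilon> nmE \<longrightarrow>
        robustly_self_ordered (c * 2 powr (l + 1)) (ext_graph_verts N) (ext_graph_edges N nmE))"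
proof -
  have rso: "robustly_self_ordered ((1 / 2 - \<epsilon>) ^ 3 / 128 * 2 powr (l + 1))
      (ext_graph_verts N) (ext_graph_edges N nmE)"
    if N: "real N = 2 powr l" and k: "k \<le> l - 2 + log 2 (1 / 2 - \<epsilon>)"
      and nmE: "nmE \<in> {1..N} \<rightarrow> {1..N} \<rightarrow> {0, 1}" and "quasi_orthogonal N \<epsilon> nmE"
      and "nm_two_source_extractor_perm N k \<epsilon> nmE"
    for l k :: real and N :: nat and nmE :: "nat \<Rightarrow> nat \<Rightarrow> nat"
  proof -
    have "2 powr k \<le> 2 powr (l - 2 + log 2 (1 / 2 - \<epsilon>))" using k by simp
    \<comment> \<open>The bound on \<open>k\<close> is the logarithmic form of this threshold: half
      of a moved set with more than \<open>(1/2 - \<epsilon>) N / 2\<close> points must carry a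
      source of min-entropy \<open>k\<close>.\<close>
    also have "\<dots> = (1 / 2 - \<epsilon>) * real N / 4"
      using assms N by (simp add: powr_add powr_diff)
    finally have "2 powr k \<le> (1 / 2 - \<epsilon>) * real N / 4" .
    moreover have "nmE x y \<in> {0, 1}" if "x \<in> {1..N}" "y \<in> {1..N}" for x y
      using nmE that by (meson PiE)
    moreover have "2 powr (l + 1) = 2 * real N" using N by (simp add: powr_add)
    ultimately show ?thesis
      using ext_graph_robustly_self_ordered[OF assms] that(4,5) by metis
  qed
  have c: "(1 / 2 - \<epsilon>) ^ 3 / 128 > 0" using assms by simp
  show ?thesis
    using c rso nm_two_source_extractor_imp_perm by blast
qed

end
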